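(* Let $\mathcal{M}$ be a finite-horizon Dec-POMDP with agent set $\mathcal{N}$ and an environment agent, satisfying the independence assumption stated in the context, and fix a joint policy $\bm{\pi}=\langle\pi_1,\dots,\pi_N\rangle$ with its induced stochastic process. Let $X_e=S_{e,0:T}$ be the environment state sequence, $Y_i=O_{i,0:T}$ the observation sequence of agent $i$, and $Y_A=\{Y_i:i\in A\}$ for $A\subseteq\mathcal{N}$. Then the set function $$g_e(Y_A):=I(X_e;Y_A),\qquad A\subseteq\mathcal{N},$$ is monotone and submodular; that is, for all $A\subseteq B\subseteq\mathcal{N}$ and $j\in\mathcal{N}\setminus B$, $I(X_e;Y_A)\le I(X_e;Y_B)$ and $$I(X_e;Y_{A\cup\{j\}})-I(X_e;Y_A)\ \ge\ I(X_e;Y_{B\cup\{j\}})-I(X_e;Y_B).$$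
   Context: **Dec-POMDP.** $\mathcal{M}=\langle T,\mathcal{N},\mathcal{S},\mathcal{A},\mathcal{O},P,\mu,\{E_i\}\rangle$: horizon $T\in\mathbb{N}$; agents $\mathcal{N}=\{1,\dots,N\}$; finite state set $\mathcal{S}$; joint action set $\mathcal{A}=\prod_i\mathcal{A}_i$ and joint observation set $\mathcal{O}=\prod_i\mathcal{O}_i$ (all finite); transition function $P:\mathcal{S}\times\mathcal{A}\to\mathcal{D}(\mathcal{S})$, where $\mathcal{D}(\cdot)$ denotes the set of probability distributions; initial distribution $\mu$; emission functions $E_i:\mathcal{S}\to\mathcal{D}(\mathcal{O}_i)$. A policy of agent $i$ is a map $\pi_i$ sending each local history $(o_{i,0},a_{i,0},o_{i,1},\dots,o_{i,t})$ to a distribution on $\mathcal{A}_i$. A joint policy $\langle\pi_1,\dots,\pi_N\rangle$ induces a stochastic process: $S_0\sim\mu$; at each time $t$, given the past and $S_t$, agent $i$ observes $O_{i,t}\sim E_i(S_t)$; given the past, the agents independently draw $A_{i,t}\sim\pi_i(\cdot\mid O_{i,0:t},A_{i,0:t-1})$; and $S_{t+1}\sim P(S_t,A_t)$. **Independence assumption.** Each joint state is $s=\langle s_e,s_1,\dots,s_N\rangle$, with $s_e$ the state of an (uncontrolled) environment agent and $s_i$ the state of agent $i$. Given $S_t$ (and the past), the observations $O_{1,t},\dots,O_{N,t}$ are independent. There are transition functions $P_e,P_1,\dots,P_N$ with $$P((s_e',s_1',\dots,s_N')\mid(s_e,s_1,\dots,s_N),(a_1,\dots,a_N))=P_e(s_e'\mid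 s_e)\prod_{i=1}^N P_i(s_i'\mid s_i,a_i);$$ the initial distribution factors as $\mu_{0,e}(s_e)\prod_{i=1}^N\mu_{0,i}(s_i)$; and $E_i(s_e,s_1,\dots,s_N)$ depends only on $(s_e,s_i)$. $I(\cdot;\cdot)$ is mutual information. *)

theory Defs
  imports "HOL-Probability.Probability"
begin

text \<open>
  Distributions on a finite set are \<open>pmf\<close>s whose support lies in that set. Joint actions are
  extensional functions on the set of agents. The set of individual actions and observations
  may differ from agent to agent; they are subsets of common ambient types.
\<close>

record ('s, 'a, 'o) dec_pomdp =
  horizon :: nat
  num_agents :: nat
  states :: "'s set"
  actions :: "nat \<Rightarrow> 'a set"
  observations :: "nat \<Rightarrow> 'o set"
  trans_fn :: "'s \<Rightarrow> (nat \<Rightarrow> 'a) \<Rightarrow> 's pmf"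
  init_dist :: "'s pmf"
  emission :: "nat \<Rightarrow> 's \<Rightarrow> 'o pmf"

definition agents :: "('s, 'a, 'o) dec_pomdp \<Rightarrow> nat set" where
  "agents M = {1..num_agents M}"

definition joint_actions :: "('s, 'a, 'o) dec_pomdp \<Rightarrow> (nat \<Rightarrow> 'a) set" where
  "joint_actions M = (\<Pi>\<^sub>E i\<in>agents M. actions M i)"

definition is_dec_pomdp :: "('s, 'a, 'o) dec_pomdp \<Rightarrow> bool" where
  "is_dec_pomdp M \<longleftrightarrow>
     finite (states M) \<and>
     (\<forall>i\<in>agents M. finite (actions M i) \<and> finite (observations M i)) \<and>
     (\<forall>s\<in>states M. \<forall>a\<in>joint_actions M. set_pmf (trans_fn M s a) \<subseteq> states M) \<and>
     set_pmf (init_dist M) \<subseteq> states M \<and>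
     (\<forall>i\<in>agents M. \<forall>s\<in>states M. set_pmf (emission M i s) \<subseteq> observations M i)"

text \<open>
  A local history \<open>(o\<^sub>0, a\<^sub>0, o\<^sub>1, \<dots>, o\<^sub>t)\<close> is given by the two lists
  \<open>[o\<^sub>0, \<dots>, o\<^sub>t]\<close> and \<open>[a\<^sub>0, \<dots>, a\<^sub>t\<^sub>-\<^sub>1]\<close>.
\<close>

type_synonym ('o, 'a) local_policy = "'o list \<Rightarrow> 'a list \<Rightarrow> 'a pmf"

definition is_joint_policy ::
    "('s, 'a, 'o) dec_pomdp \<Rightarrow> (nat \<Rightarrow> ('o, 'a) local_policy) \<Rightarrow> bool" where
  "is_joint_policy M \<pi> \<longleftrightarrow>
     (\<forall>i\<in>agents M. \<forall>t\<le>horizon M. \<forall>os as.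
        length os = Suc t \<and> set os \<subseteq> observations M i \<and>
        length as = t \<and> set as \<subseteq> actions M i \<longrightarrow>
        set_pmf (\<pi> i os as) \<subseteq> actions M i)"

text \<open>
  \<open>S t\<close>, \<open>Ob i t\<close>, \<open>A i t\<close> are the random state, observation of agent \<open>i\<close> and action of agent \<open>i\<close>
  at time \<open>t\<close>; \<open>s\<close>, \<open>ob\<close>, \<open>a\<close> are values they may take. The following is the event that
  everything that happens strictly before time \<open>t\<close> agrees with these values.
\<close>

definition past_is ::
    "('s, 'a, 'o) dec_pomdp \<Rightarrow> (nat \<Rightarrow> 'w \<Rightarrow> 's) \<Rightarrow> (nat \<Rightarrow> nat \<Rightarrow> 'w \<Rightarrow> 'o) \<Rightarrow>
     (nat \<Rightarrow> nat \<Rightarrow> 'w \<Rightarrow> 'a) \<Rightarrow> (nat \<Rightarrow> 's) \<Rightarrow> (nat \<Rightarrow> nat \<Rightarrow> 'o) \<Rightarrow> (nat \<Rightarrow> nat \<Rightarrow> 'a) \<Rightarrow>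
     nat \<Rightarrow> 'w \<Rightarrow> bool" where
  "past_is M S Ob A s ob a t \<omega> \<longleftrightarrow>
     (\<forall>k<t. S k \<omega> = s k \<and> (\<forall>i\<in>agents M. Ob i k \<omega> = ob i k \<and> A i k \<omega> = a i k))"

text \<open>
  A process induced by a joint policy, on an arbitrary probability space. States and observations
  are indexed by \<open>0, \<dots>, T\<close> and transitions take place at times \<open>t < T\<close>; an action at the final
  time \<open>T\<close> influences neither, so its law is left unconstrained. In the emission clause only the
  law of each single observation is prescribed, not the joint law of the observations of
  different agents.
\<close>

definition induced_process ::
    "('s, 'a, 'o) dec_pomdp \<Rightarrow> (nat \<Rightarrow> ('o, 'a) local_policy) \<Rightarrow> 'w measure \<Rightarrow>
     (nat \<Rightarrow> 'w \<Rightarrow> 's) \<Rightarrow> (nat \<Rightarrow> nat \<Rightarrow> 'w \<Rightarrow> 'o) \<Rightarrow> (nat \<Rightarrow> nat \<Rightarrow> 'w \<Rightarrow> 'a) \<Rightarrow> bool" where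
  "induced_process M \<pi> \<Omega> S Ob A \<longleftrightarrow>
     prob_space \<Omega> \<and>
     (\<forall>t\<le>horizon M. S t \<in> measurable \<Omega> (count_space (states M))) \<and>
     (\<forall>i\<in>agents M. \<forall>t\<le>horizon M. Ob i t \<in> measurable \<Omega> (count_space (observations M i))) \<and>
     (\<forall>i\<in>agents M. \<forall>t<horizon M. A i t \<in> measurable \<Omega> (count_space (actions M i))) \<and>
     (\<forall>x\<in>states M. \<P>(\<omega> in \<Omega>. S 0 \<omega> = x) = pmf (init_dist M) x) \<and>
     (\<forall>s ob a t. t \<le> horizon M \<longrightarrow>
        \<P>(\<omega> in \<Omega>. past_is M S Ob A s ob a t \<omega> \<and> S t \<omega> = s t) > 0 \<longrightarrow>
        (\<forall>i\<in>agents M.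
          \<P>(\<omega> in \<Omega>. Ob i t \<omega> = ob i t \<bar> past_is M S Ob A s ob a t \<omega> \<and> S t \<omega> = s t)
            = pmf (emission M i (s t)) (ob i t))) \<and>
     (\<forall>s ob a t. t < horizon M \<longrightarrow>
        \<P>(\<omega> in \<Omega>. past_is M S Ob A s ob a t \<omega> \<and> S t \<omega> = s t \<and>
                   (\<forall>i\<in>agents M. Ob i t \<omega> = ob i t)) > 0 \<longrightarrow>
        \<P>(\<omega> in \<Omega>. \<forall>i\<in>agents M. A i t \<omega> = a i t \<bar>
             past_is M S Ob A s ob a t \<omega> \<and> S t \<omega> = s t \<and> (\<forall>i\<in>agents M. Ob i t \<omega> = ob i t))
          = (\<Prod>i\<in>agents M. pmf (\<pi> i (map (ob i) [0..<Suc t]) (map (a i) [0..<t])) (a i t))) \<and>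
     (\<forall>s ob a t. t < horizon M \<longrightarrow>
        \<P>(\<omega> in \<Omega>. past_is M S Ob A s ob a (Suc t) \<omega>) > 0 \<longrightarrow>
        \<P>(\<omega> in \<Omega>. S (Suc t) \<omega> = s (Suc t) \<bar> past_is M S Ob A s ob a (Suc t) \<omega>)
          = pmf (trans_fn M (s t) (\<lambda>i\<in>agents M. a i t)) (s (Suc t)))"

text \<open>
  A joint state is a pair of the environment state and an extensional function giving the
  states of the agents.
\<close>

definition factored_dec_pomdp :: "('e \<times> (nat \<Rightarrow> 'l), 'a, 'o) dec_pomdp \<Rightarrow> bool" where
  "factored_dec_pomdp M \<longleftrightarrow>
     (\<exists>Se Sl Pe Pl \<mu>e \<mu>l.
        states M = Se \<times> (\<Pi>\<^sub>E i\<in>agents M. Sl i) \<and>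
        (\<forall>x\<in>Se. set_pmf (Pe x) \<subseteq> Se) \<and>
        (\<forall>i\<in>agents M. \<forall>x\<in>Sl i. \<forall>c\<in>actions M i. set_pmf (Pl i x c) \<subseteq> Sl i) \<and>
        set_pmf \<mu>e \<subseteq> Se \<and>
        (\<forall>i\<in>agents M. set_pmf (\<mu>l i) \<subseteq> Sl i) \<and>
        (\<forall>(x, y)\<in>states M. \<forall>(x', y')\<in>states M. \<forall>c\<in>joint_actions M.
           pmf (trans_fn M (x, y) c) (x', y')
             = pmf (Pe x) x' * (\<Prod>i\<in>agents M. pmf (Pl i (y i) (c i)) (y' i))) \<and>
        (\<forall>(x, y)\<in>states M.
           pmf (init_dist M) (x, y) = pmf \<mu>e x * (\<Prod>i\<in>agents M. pmf (\<mu>l i) (y i)))) \<and>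
     (\<forall>i\<in>agents M. \<forall>(x, y)\<in>states M. \<forall>(x', y')\<in>states M.
        x = x' \<and> y i = y' i \<longrightarrow> emission M i (x, y) = emission M i (x', y'))"

text \<open>
  Since all observations take finitely many values, mutual conditional independence is the
  product formula for the joint conditional point probabilities.
\<close>

definition cond_indep_observations ::
    "('s, 'a, 'o) dec_pomdp \<Rightarrow> 'w measure \<Rightarrow>
     (nat \<Rightarrow> 'w \<Rightarrow> 's) \<Rightarrow> (nat \<Rightarrow> nat \<Rightarrow> 'w \<Rightarrow> 'o) \<Rightarrow> (nat \<Rightarrow> nat \<Rightarrow> 'w \<Rightarrow> 'a) \<Rightarrow> bool" where
  "cond_indep_observations M \<Omega> S Ob A \<longleftrightarrow>
     (\<forall>s ob a t. t \<le> horizon M \<longrightarrow>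
        \<P>(\<omega> in \<Omega>. past_is M S Ob A s ob a t \<omega> \<and> S t \<omega> = s t) > 0 \<longrightarrow>
        \<P>(\<omega> in \<Omega>. \<forall>i\<in>agents M. Ob i t \<omega> = ob i t \<bar>
             past_is M S Ob A s ob a t \<omega> \<and> S t \<omega> = s t)
          = (\<Prod>i\<in>agents M.
               \<P>(\<omega> in \<Omega>. Ob i t \<omega> = ob i t \<bar> past_is M S Ob A s ob a t \<omega> \<and> S t \<omega> = s t)))"

definition env_sequence :: "nat \<Rightarrow> (nat \<Rightarrow> 'w \<Rightarrow> 'e \<times> (nat \<Rightarrow> 'l)) \<Rightarrow> 'w \<Rightarrow> 'e list" where
  "env_sequence T S \<omega> = map (\<lambda>t. fst (S t \<omega>)) [0..<Suc T]"

definition obs_sequence :: "nat \<Rightarrow> (nat \<Rightarrow> nat \<Rightarrow> 'w \<Rightarrow> 'o) \<Rightarrow> nat \<Rightarrow> 'w \<Rightarrow> 'o list" where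
  "obs_sequence T Ob i \<omega> = map (\<lambda>t. Ob i t \<omega>) [0..<Suc T]"

definition obs_family ::
    "nat \<Rightarrow> (nat \<Rightarrow> nat \<Rightarrow> 'w \<Rightarrow> 'o) \<Rightarrow> nat set \<Rightarrow> 'w \<Rightarrow> nat \<Rightarrow> 'o list" where
  "obs_family T Ob C \<omega> = (\<lambda>i\<in>C. obs_sequence T Ob i \<omega>)"

text \<open>
  The library's mutual information (to base \<open>b\<close>) of two random variables with finite range,
  i.e. what \<open>\<I>(X ; Y)\<close> abbreviates inside the locale \<open>information_space\<close>.
\<close>

definition mutual_info :: "real \<Rightarrow> 'w measure \<Rightarrow> ('w \<Rightarrow> 'x) \<Rightarrow> ('w \<Rightarrow> 'y) \<Rightarrow> real" where
  "mutual_info b \<Omega> X Y =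
     prob_space.mutual_information \<Omega> b
       (count_space (X ` space \<Omega>)) (count_space (Y ` space \<Omega>)) X Y"

definition env_info ::
    "real \<Rightarrow> ('e \<times> (nat \<Rightarrow> 'l), 'a, 'o) dec_pomdp \<Rightarrow> 'w measure \<Rightarrow>
     (nat \<Rightarrow> 'w \<Rightarrow> 'e \<times> (nat \<Rightarrow> 'l)) \<Rightarrow> (nat \<Rightarrow> nat \<Rightarrow> 'w \<Rightarrow> 'o) \<Rightarrow> nat set \<Rightarrow> real" where
  "env_info b M \<Omega> S Ob C =
     mutual_info b \<Omega> (env_sequence (horizon M) S) (obs_family (horizon M) Ob C)"

end

theory Submission
  imports Defs
begin

text \<open>
  Multiplying out the laws of the process, the joint law of all states, observations and actions is
  a function of the environment trajectory times a product over the agents, the \<open>i\<close>-th factor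
  depending only on the environment trajectory and on the trajectory of agent \<open>i\<close>. Summing out the
  local states and actions gives \<open>P(X\<^sub>e = x, Y = y) = g x * (\<Prod>i. h i x (y i))\<close>, so the observation
  sequences are conditionally independent given \<open>X\<^sub>e\<close>. Consequently
  \<open>I(X\<^sub>e; Y\<^sub>A\<^sub>\<union>\<^sub>j) - I(X\<^sub>e; Y\<^sub>A) = H(Y\<^sub>j | Y\<^sub>A) - H(Y\<^sub>j | X\<^sub>e)\<close>, which decreases in \<open>A\<close> because conditioning
  reduces entropy.
\<close>

subsection \<open>Mutual information of simple functions\<close>

lemma simple_function_Collect:
  assumes "simple_function M f"
  shows "{\<omega> \<in> space M. f \<omega> = v} \<in> sets M"
  using simple_functionD(2)[OF assms, of "{v}"] by (simp add: vimage_def Int_def conj_commute)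

text \<open>The process is given by maps into \<open>count_space B\<close> with \<open>B\<close>
  finite, whereas the entropy rules used below ask for simple functions.\<close>

lemma simple_function_measurable_finite:
  assumes f: "f \<in> measurable M (count_space B)" and B: "finite B"
  shows "simple_function M f"
proof -
  have "f ` space M \<subseteq> B"
    using measurable_space[OF f] by auto
  \<comment> \<open>Composing with the identity enlarges the codomain to \<open>UNIV\<close>, the
    form that \<open>simple_function_eq_measurable\<close> expects.\<close>
  moreover have "(\<lambda>x. x) \<circ> f \<in> measurable M (count_space UNIV)"
    by (rule measurable_comp[OF f]) simp
  ultimately show ?thesis
    using B by (auto simp: simple_function_eq_measurable comp_def intro: finite_subset)
qed

text \<open>Law of total probability over the values of \<open>R\<close>. The set \<open>B\<close>
  may be any finite set containing the values that \<open>R\<close> takes on \<open>Q\<close>, for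
  instance a product set.\<close>

lemma (in prob_space) prob_eq_sum_values:
  assumes B: "finite B" and R: "\<And>\<omega>. \<omega> \<in> space M \<Longrightarrow> Q \<omega> \<Longrightarrow> R \<omega> \<in> B"
    and Q: "{\<omega> \<in> space M. Q \<omega>} \<in> events"
    and QR: "\<And>r. r \<in> B \<Longrightarrow> {\<omega> \<in> space M. Q \<omega> \<and> R \<omega> = r} \<in> events"
  shows "\<P>(\<omega> in M. Q \<omega>) = (\<Sum>r\<in>B. \<P>(\<omega> in M. Q \<omega> \<and> R \<omega> = r))"
  using B QR Q
proof (rule prob_sum)
  show "AE \<omega> in M. (\<forall>r\<in>B. Q \<omega> \<and> R \<omega> = r \<longrightarrow> Q \<omega>) \<and>
      (Q \<omega> \<longrightarrow> (\<exists>!r\<in>B. Q \<omega> \<and> R \<omega> = r))"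
  proof (intro AE_I2 conjI ballI impI)
    fix \<omega> assume "\<omega> \<in> space M" "Q \<omega>"
    then show "\<exists>!r\<in>B. Q \<omega> \<and> R \<omega> = r"
      using R[of \<omega>] by (intro ex1I[of _ "R \<omega>"]) auto
  qed simp
qed

context information_space
begin

text \<open>Grouping the values \<open>w\<close> by \<open>f w\<close> writes the entropy of every
  marginal of \<open>W\<close> as a sum over the one range of \<open>W\<close>. Entropies of
  different marginals can then be compared term by term.\<close>

lemma entropy_comp_eq_sum:
  assumes W: "simple_function M W"
  shows "\<H>(\<lambda>\<omega>. f (W \<omega>)) =
    - (\<Sum>w\<in>W ` space M. \<P>(\<omega> in M. W \<omega> = w) * log b \<P>(\<omega> in M. f (W \<omega>) = f w))"
proof -
  have sf: "simple_function M (\<lambda>\<omega>. f (W \<omega>))"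
    by (rule simple_function_compose1[OF W])
  have ev: "{\<omega> \<in> space M. g (W \<omega>) = u} \<in> events" for g :: "'b \<Rightarrow> 'd" and u
    by (rule simple_function_Collect[OF simple_function_compose1[OF W]])
  have marg: "\<P>(\<omega> in M. f (W \<omega>) = v) = (\<Sum>w\<in>{w \<in> W ` space M. f w = v}. \<P>(\<omega> in M. W \<omega> = w))" for v
  proof -
    have "\<P>(\<omega> in M. f (W \<omega>) = v) =
        (\<Sum>w\<in>{w \<in> W ` space M. f w = v}. \<P>(\<omega> in M. f (W \<omega>) = v \<and> W \<omega> = w))"
      using ev[of "\<lambda>w. w"]
      by (intro prob_eq_sum_values ev) (auto simp: simple_functionD(1)[OF W] cong: rev_conj_cong)
    also have "\<dots> = (\<Sum>w\<in>{w \<in> W ` space M. f w = v}. \<P>(\<omega> in M. W \<omega> = w))"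
      by (intro sum.cong refl arg_cong[where f=prob]) auto
    finally show ?thesis .
  qed
  have "\<H>(\<lambda>\<omega>. f (W \<omega>)) = - (\<Sum>v\<in>(\<lambda>\<omega>. f (W \<omega>)) ` space M.
      \<P>(\<omega> in M. f (W \<omega>) = v) * log b \<P>(\<omega> in M. f (W \<omega>) = v))"
    by (rule entropy_simple_distributed, rule simple_distributedI[OF sf])
       (auto intro!: arg_cong[where f=prob])
  also have "(\<lambda>\<omega>. f (W \<omega>)) ` space M = f ` W ` space M"
    by auto
  also have "(\<Sum>v\<in>f ` W ` space M. \<P>(\<omega> in M. f (W \<omega>) = v) * log b \<P>(\<omega> in M. f (W \<omega>) = v)) =
    (\<Sum>v\<in>f ` W ` space M. \<Sum>w\<in>{w \<in> W ` space M. f w = v}.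
       \<P>(\<omega> in M. W \<omega> = w) * log b \<P>(\<omega> in M. f (W \<omega>) = f w))"
    by (intro sum.cong refl, subst (1) marg) (simp add: sum_distrib_right)
  also have "\<dots> = (\<Sum>w\<in>W ` space M. \<P>(\<omega> in M. W \<omega> = w) * log b \<P>(\<omega> in M. f (W \<omega>) = f w))"
    using simple_functionD(1)[OF W] by (rule sum.image_gen[symmetric])
  finally show ?thesis by (simp add: image_image)
qed

text \<open>Both facts come from writing the conditional mutual information as a sum over the range
  of the triple: splitting the logarithm gives the four entropies, and the product condition makes
  its argument 1.\<close>

lemma
  assumes X: "simple_function M X" and Y: "simple_function M Y" and Z: "simple_function M Z"
  shows conditional_mutual_information_eq_entropy: "\<I>(X ; Y | Z) =
    \<H>(\<lambda>\<omega>. (X \<omega>, Z \<omega>)) + \<H>(\<lambda>\<omega>. (Y \<omega>, Z \<omega>)) - \<H>(Z) - \<H>(\<lambda>\<omega>. (X \<omega>, Y \<omega>, Z \<omega>))"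
    and conditional_mutual_information_eq_0: "(\<And>x y z. \<P>(\<omega> in M. X \<omega> = x \<and> Y \<omega> = y \<and> Z \<omega> = z) * \<P>(\<omega> in M. Z \<omega> = z) =
        \<P>(\<omega> in M. X \<omega> = x \<and> Z \<omega> = z) * \<P>(\<omega> in M. Y \<omega> = y \<and> Z \<omega> = z)) \<Longrightarrow> \<I>(X ; Y | Z) = 0"
    (is "PROP ?indep \<Longrightarrow> _")
proof -
  let ?W = "\<lambda>\<omega>. (X \<omega>, Y \<omega>, Z \<omega>)"
  have W: "simple_function M ?W"
    by (intro simple_function_Pair X Y Z)
  let ?P = "\<lambda>V v. \<P>(\<omega> in M. V \<omega> = v)"
  define p where "p = ?P ?W"
  define pxz where "pxz w = ?P (\<lambda>\<omega>. (X \<omega>, Z \<omega>)) (fst w, snd (snd w))" for w :: "'b \<times> 'c \<times> 'd"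
  define pyz where "pyz w = ?P (\<lambda>\<omega>. (Y \<omega>, Z \<omega>)) (snd w)" for w :: "'b \<times> 'c \<times> 'd"
  define pz where "pz w = ?P Z (snd (snd w))" for w :: "'b \<times> 'c \<times> 'd"
  note p_defs = p_def pxz_def pyz_def pz_def
  have sd: "simple_distributed M V (?P V)" if "simple_function M V" for V :: "'a \<Rightarrow> 'v"
    by (rule simple_distributedI[OF that]) (auto intro!: arg_cong[where f=prob])
  have "\<I>(X ; Y | Z) = (\<Sum>(x, y, z)\<in>?W ` space M. ?P ?W (x, y, z) * log b (?P ?W (x, y, z) /
     (?P (\<lambda>\<omega>. (X \<omega>, Z \<omega>)) (x, z) * (?P (\<lambda>\<omega>. (Y \<omega>, Z \<omega>)) (y, z) / ?P Z z))))"
    by (rule conditional_mutual_information_eq) (intro sd simple_function_Pair X Y Z)+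
  then have eq: "\<I>(X ; Y | Z) =
      (\<Sum>w\<in>?W ` space M. p w * log b (p w / (pxz w * (pyz w / pz w))))"
    by (simp only: p_defs split_def prod.collapse)
  \<comment> \<open>A marginal dominates the joint probability, so all marginals are positive
    wherever \<open>p\<close> is. The range of \<open>?W\<close> may still contain values of
    probability 0.\<close>
  have le: "p w \<le> \<P>(\<omega> in M. f (?W \<omega>) = f w)" for w and f :: "'b \<times> 'c \<times> 'd \<Rightarrow> 'v"
    unfolding p_def
    by (intro finite_measure_mono simple_function_Collect[OF simple_function_compose1[OF W]]) auto
  have pos: "0 < p w" "0 < pxz w" "0 < pyz w" "0 < pz w" if "p w \<noteq> 0" for w
  proof -
    show "0 < p w" using that by (simp add: p_def zero_less_measure_iff)
    then show "0 < pxz w" "0 < pyz w" "0 < pz w"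
      using le[of w "\<lambda>(x, y, z). (x, z)"] le[of w snd] le[of w "\<lambda>(x, y, z). z"]
      by (simp_all add: p_defs split_def)
  qed
  \<comment> \<open>For \<open>p w = 0\<close> both sides vanish; otherwise all four probabilities
    are positive and the logarithm of the quotient splits.\<close>
  have "p w * log b (p w / (pxz w * (pyz w / pz w))) =
      p w * log b (p w) + p w * log b (pz w) - p w * log b (pxz w) - p w * log b (pyz w)" for w
    using pos[of w] by (cases "p w = 0") (simp_all add: log_divide log_mult algebra_simps)
  moreover have "\<H>(\<lambda>\<omega>. (X \<omega>, Z \<omega>)) = - (\<Sum>w\<in>?W ` space M. p w * log b (pxz w))"
    using entropy_comp_eq_sum[OF W, of "\<lambda>(x, y, z). (x, z)"] by (simp add: p_defs split_def)
  moreover have "\<H>(\<lambda>\<omega>. (Y \<omega>, Z \<omega>)) = - (\<Sum>w\<in>?W ` space M. p w * log b (pyz w))"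
    using entropy_comp_eq_sum[OF W, of snd] by (simp add: p_defs)
  moreover have "\<H>(Z) = - (\<Sum>w\<in>?W ` space M. p w * log b (pz w))"
    using entropy_comp_eq_sum[OF W, of "\<lambda>(x, y, z). z"] by (simp add: p_defs split_def)
  moreover have "\<H>(?W) = - (\<Sum>w\<in>?W ` space M. p w * log b (p w))"
    using entropy_comp_eq_sum[OF W, of "\<lambda>w. w"] by (simp add: p_defs)
  ultimately show "\<I>(X ; Y | Z) =
      \<H>(\<lambda>\<omega>. (X \<omega>, Z \<omega>)) + \<H>(\<lambda>\<omega>. (Y \<omega>, Z \<omega>)) - \<H>(Z) - \<H>(\<lambda>\<omega>. (X \<omega>, Y \<omega>, Z \<omega>))"
    unfolding eq by (simp add: sum.distrib sum_subtractf)
  assume indep: "PROP ?indep"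
  have "p w * pz w = pxz w * pyz w" for w
    using indep[of "fst w" "fst (snd w)" "snd (snd w)"] by (simp add: p_defs prod_eq_iff)
  then have "p w * log b (p w / (pxz w * (pyz w / pz w))) = 0" for w
    using pos[of w] by (cases "p w = 0") (simp_all add: field_simps)
  then show "\<I>(X ; Y | Z) = 0"
    unfolding eq by (simp only: sum.neutral_const)
qed

lemma mutual_information_eq_entropy:
  assumes X: "simple_function M X" and Y: "simple_function M Y"
  shows "\<I>(X ; Y) = \<H>(X) + \<H>(Y) - \<H>(\<lambda>\<omega>. (X \<omega>, Y \<omega>))"
proof -
  \<comment> \<open>The chain rule that brings in the entropy of \<open>X\<close> given
    \<open>Y\<close> speaks of the pair with \<open>Y\<close> first, so the pair is swapped.\<close>
  have "\<H>(\<lambda>\<omega>. (Y \<omega>, X \<omega>)) = \<H>((\<lambda>(x, y). (y, x)) \<circ> (\<lambda>\<omega>. (X \<omega>, Y \<omega>)))"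
    by (simp add: comp_def)
  also have "\<dots> = \<H>(\<lambda>\<omega>. (X \<omega>, Y \<omega>))"
    by (rule entropy_of_inj) (auto intro: simple_function_Pair X Y simp: inj_on_def)
  finally show ?thesis
    using mutual_information_eq_entropy_conditional_entropy[OF X Y] entropy_chain_rule[OF Y X] by simp
qed

section \<open>Invariance under injections, data processing and diminishing returns\<close>

lemma entropy_inj:
  assumes "simple_function M W" "inj_on f (W ` space M)"
  shows "\<H>(\<lambda>\<omega>. f (W \<omega>)) = \<H>(W)"
  using entropy_of_inj[OF assms] by (simp add: comp_def)

lemma mutual_information_inj:
  assumes X: "simple_function M X" and Y: "simple_function M Y" and f: "inj_on f (Y ` space M)"
  shows "\<I>(X ; \<lambda>\<omega>. f (Y \<omega>)) = \<I>(X ; Y)"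
proof -
  have fY: "simple_function M (\<lambda>\<omega>. f (Y \<omega>))"
    by (rule simple_function_compose1[OF Y])
  have "\<H>(\<lambda>\<omega>. (X \<omega>, f (Y \<omega>))) = \<H>(\<lambda>\<omega>. (X \<omega>, Y \<omega>))"
    using entropy_inj[OF simple_function_Pair[OF X Y], of "\<lambda>(x, y). (x, f y)"] f
    by (auto simp: inj_on_def)
  then show ?thesis
    using entropy_inj[OF Y f]
    by (simp add: mutual_information_eq_entropy[OF X Y] mutual_information_eq_entropy[OF X fY])
qed

text \<open>Since \<open>Y\<close> determines \<open>f Y\<close>, the nonnegative quantity I(X ; Y |
  f(Y)) expands in entropies to exactly I(X ; Y) - I(X ; f(Y)).\<close>

lemma mutual_information_data_processing:
  assumes X: "simple_function M X" and Y: "simple_function M Y"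
  shows "\<I>(X ; \<lambda>\<omega>. f (Y \<omega>)) \<le> \<I>(X ; Y)"
proof -
  have fY: "simple_function M (\<lambda>\<omega>. f (Y \<omega>))"
    by (rule simple_function_compose1[OF Y])
  have "0 \<le> \<I>(X ; Y | \<lambda>\<omega>. f (Y \<omega>))"
    by (rule conditional_mutual_information_nonneg[OF X Y fY])
  also have "\<dots> = \<H>(\<lambda>\<omega>. (X \<omega>, f (Y \<omega>))) + \<H>(Y) - \<H>(\<lambda>\<omega>. f (Y \<omega>)) - \<H>(\<lambda>\<omega>. (X \<omega>, Y \<omega>))"
    using entropy_inj[OF Y, of "\<lambda>y. (y, f y)"]
      entropy_inj[OF simple_function_Pair[OF X Y], of "\<lambda>(x, y). (x, y, f y)"]
    by (simp add: conditional_mutual_information_eq_entropy[OF X Y fY] inj_on_def split_def)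
  finally show ?thesis
    by (simp add: mutual_information_eq_entropy[OF X Y] mutual_information_eq_entropy[OF X fY])
qed

text \<open>For \<open>V\<close> equal to \<open>W\<close> or to its image under \<open>f\<close>,
  the gain from adding \<open>Y\<close> to \<open>V\<close> is H(Y | V) - H(Y | X). The two gains
  therefore differ by H(Y | f(W)) - H(Y | W) = I(Y ; W | f(W)), which is nonnegative.\<close>

lemma mutual_information_diminishing_returns:
  assumes X: "simple_function M X" and Y: "simple_function M Y" and W: "simple_function M W"
    and indep: "\<I>(Y ; W | X) = 0" "\<I>(Y ; (\<lambda>\<omega>. f (W \<omega>)) | X) = 0"
  shows "\<I>(X ; \<lambda>\<omega>. (Y \<omega>, W \<omega>)) - \<I>(X ; W) \<le>
    \<I>(X ; \<lambda>\<omega>. (Y \<omega>, f (W \<omega>))) - \<I>(X ; \<lambda>\<omega>. f (W \<omega>))"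
proof -
  have fW: "simple_function M (\<lambda>\<omega>. f (W \<omega>))"
    by (rule simple_function_compose1[OF W])
  \<comment> \<open>Independence of \<open>Y\<close> and \<open>V\<close> given \<open>X\<close>
    replaces the entropy of the triple by H(V, X) + H(Y, X) - H(X). The part of the gain that
    involves \<open>X\<close> then no longer depends on \<open>V\<close>.\<close>
  have gain: "\<I>(X ; \<lambda>\<omega>. (Y \<omega>, V \<omega>)) - \<I>(X ; V) =
      \<H>(\<lambda>\<omega>. (Y \<omega>, V \<omega>)) - \<H>(V) - (\<H>(\<lambda>\<omega>. (Y \<omega>, X \<omega>)) - \<H>(X))"
    if V: "simple_function M V" and 0: "\<I>(Y ; V | X) = 0" for V :: "'a \<Rightarrow> 'v"
  proof -
    have "\<H>(\<lambda>\<omega>. (V \<omega>, X \<omega>)) = \<H>(\<lambda>\<omega>. (X \<omega>, V \<omega>))"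
      using entropy_inj[OF simple_function_Pair[OF X V], of "\<lambda>(x, v). (v, x)"]
      by (simp add: inj_on_def)
    moreover have "\<H>(\<lambda>\<omega>. (Y \<omega>, V \<omega>, X \<omega>)) = \<H>(\<lambda>\<omega>. (X \<omega>, Y \<omega>, V \<omega>))"
      using entropy_inj[OF simple_function_Pair[OF X simple_function_Pair[OF Y V]],
          of "\<lambda>(x, y, v). (y, v, x)"]
      by (simp add: inj_on_def)
    ultimately show ?thesis
      using 0 mutual_information_eq_entropy[OF X V]
        mutual_information_eq_entropy[OF X simple_function_Pair[OF Y V]]
        conditional_mutual_information_eq_entropy[OF Y V X]
      by simp
  qed
  \<comment> \<open>Adjoining \<open>f W\<close> to a tuple that already contains \<open>W\<close>
    is injective, so it disappears from the entropies.\<close>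
  have "0 \<le> \<I>(Y ; W | \<lambda>\<omega>. f (W \<omega>))"
    by (rule conditional_mutual_information_nonneg[OF Y W fW])
  also have "\<dots> = \<H>(\<lambda>\<omega>. (Y \<omega>, f (W \<omega>))) + \<H>(W) - \<H>(\<lambda>\<omega>. f (W \<omega>)) - \<H>(\<lambda>\<omega>. (Y \<omega>, W \<omega>))"
    using entropy_inj[OF W, of "\<lambda>y. (y, f y)"]
      entropy_inj[OF simple_function_Pair[OF Y W], of "\<lambda>(x, y). (x, y, f y)"]
    by (simp add: conditional_mutual_information_eq_entropy[OF Y W fW] inj_on_def split_def)
  finally show ?thesis
    unfolding gain[OF W indep(1)] gain[OF fW indep(2)] by simp
qed

end

subsection \<open>Families of conditionally independent random variables\<close>

lemma restrict_eq_iff: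
  "c \<in> extensional J \<Longrightarrow> restrict f J = c \<longleftrightarrow> (\<forall>i\<in>J. f i = c i)"
  by (auto simp: fun_eq_iff extensional_def restrict_def)

lemma eq_restrict_iff:
  "c \<in> extensional J \<Longrightarrow> c = restrict f J \<longleftrightarrow> (\<forall>i\<in>J. c i = f i)"
  by (auto simp: fun_eq_iff extensional_def restrict_def)

lemma (in prob_space) simple_function_family:
  assumes "finite I" "\<And>i. i \<in> I \<Longrightarrow> simple_function M (Y i)"
  shows "simple_function M (\<lambda>\<omega>. \<lambda>i\<in>I. Y i \<omega>)"
  unfolding simple_function_def
proof (intro conjI ballI)
  show "finite ((\<lambda>\<omega>. \<lambda>i\<in>I. Y i \<omega>) ` space M)"
  proof (rule finite_subset)
    show "finite (\<Pi>\<^sub>E i\<in>I. Y i ` space M)"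
      using assms by (intro finite_PiE simple_functionD(1))
  qed auto
next
  fix y assume "y \<in> (\<lambda>\<omega>. \<lambda>i\<in>I. Y i \<omega>) ` space M"
  then have "y \<in> extensional I"
    by auto
  then have "(\<lambda>\<omega>. \<lambda>i\<in>I. Y i \<omega>) -` {y} \<inter> space M = {\<omega> \<in> space M. \<forall>i\<in>I. Y i \<omega> = y i}"
    by (auto simp: restrict_eq_iff)
  also have "\<dots> \<in> events"
    using assms by (intro sets.sets_Collect_finite_All simple_function_Collect)
  finally show "(\<lambda>\<omega>. \<lambda>i\<in>I. Y i \<omega>) -` {y} \<inter> space M \<in> events" .
qed

text \<open>Summing over the values of the variables outside \<open>C\<close> and distributing the
  product over the sums. The functions \<open>h i\<close> need not be normalised, so their total
  masses remain as factors.\<close>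

lemma (in prob_space) marginal_of_product_form:
  assumes I: "finite I" and X: "simple_function M X"
    and Y: "\<And>i. i \<in> I \<Longrightarrow> simple_function M (Y i)"
    and fact: "\<And>y. \<P>(\<omega> in M. X \<omega> = x \<and> (\<forall>i\<in>I. Y i \<omega> = y i)) = g * (\<Prod>i\<in>I. h i (y i))"
    and C: "C \<subseteq> I"
  shows "\<P>(\<omega> in M. X \<omega> = x \<and> (\<forall>i\<in>C. Y i \<omega> = y i)) =
    g * (\<Prod>i\<in>C. h i (y i)) * (\<Prod>i\<in>I - C. \<Sum>v\<in>Y i ` space M. h i v)"
proof -
  have fin: "finite C" "finite (I - C)"
    using I C by (auto intro: finite_subset)
  have evX: "{\<omega> \<in> space M. X \<omega> = x} \<in> events"
    by (rule simple_function_Collect[OF X])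
  have evY: "{\<omega> \<in> space M. Y i \<omega> = v} \<in> events" if "i \<in> I" for i v
    by (rule simple_function_Collect[OF Y[OF that]])
  have ev: "{\<omega> \<in> space M. X \<omega> = x \<and> (\<forall>i\<in>J. Y i \<omega> = z i)} \<in> events" if "J \<subseteq> I" for J z
    using that by (intro sets.sets_Collect_conj evX sets.sets_Collect_finite_All evY)
      (auto intro: finite_subset I)
  let ?R = "\<lambda>\<omega>. \<lambda>i\<in>I - C. Y i \<omega>" and ?B = "\<Pi>\<^sub>E i\<in>I - C. Y i ` space M"
  \<comment> \<open>The values \<open>y\<close> on \<open>C\<close> and \<open>r\<close> outside
    \<open>C\<close> are joined into one assignment on \<open>I\<close>, to which
    \<open>fact\<close> applies.\<close>
  have glue: "X \<omega> = x \<and> (\<forall>i\<in>C. Y i \<omega> = y i) \<and> ?R \<omega> = r \<longleftrightarrow>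
      X \<omega> = x \<and> (\<forall>i\<in>I. Y i \<omega> = (if i \<in> C then y i else r i))" if "r \<in> ?B" for r \<omega>
    using C that by (auto simp: fun_eq_iff PiE_def extensional_def restrict_def)
  have "\<P>(\<omega> in M. X \<omega> = x \<and> (\<forall>i\<in>C. Y i \<omega> = y i)) =
      (\<Sum>r\<in>?B. \<P>(\<omega> in M. (X \<omega> = x \<and> (\<forall>i\<in>C. Y i \<omega> = y i)) \<and> ?R \<omega> = r))"
  proof (rule prob_eq_sum_values)
    show "finite ?B"
      using fin Y by (intro finite_PiE simple_functionD(1)) auto
    show "{\<omega> \<in> space M. (X \<omega> = x \<and> (\<forall>i\<in>C. Y i \<omega> = y i)) \<and> ?R \<omega> = r} \<in> events" if "r \<in> ?B" for r
      using ev[of I] by (simp only: conj_assoc glue[OF that] order_refl)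
  qed (use ev C in auto)
  also have "\<dots> = (\<Sum>r\<in>?B. g * (\<Prod>i\<in>C. h i (y i)) * (\<Prod>i\<in>I - C. h i (r i)))"
  proof (rule sum.cong[OF refl])
    fix r assume r: "r \<in> ?B"
    have "\<P>(\<omega> in M. (X \<omega> = x \<and> (\<forall>i\<in>C. Y i \<omega> = y i)) \<and> ?R \<omega> = r) =
        g * (\<Prod>i\<in>I. h i (if i \<in> C then y i else r i))"
      unfolding fact[symmetric] by (simp only: conj_assoc glue[OF r])
    also have "(\<Prod>i\<in>I. h i (if i \<in> C then y i else r i)) =
        (\<Prod>i\<in>I - C. h i (r i)) * (\<Prod>i\<in>C. h i (y i))"
      by (subst prod.subset_diff[OF C I]) simp
    finally show "\<P>(\<omega> in M. (X \<omega> = x \<and> (\<forall>i\<in>C. Y i \<omega> = y i)) \<and> ?R \<omega> = r) =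
        g * (\<Prod>i\<in>C. h i (y i)) * (\<Prod>i\<in>I - C. h i (r i))"
      by (simp only: mult_ac)
  qed
  also have "\<dots> = g * (\<Prod>i\<in>C. h i (y i)) * (\<Prod>i\<in>I - C. \<Sum>v\<in>Y i ` space M. h i v)"
    using fin(2) Y by (subst prod_sum_PiE) (auto intro: simple_functionD(1) simp: sum_distrib_left)
  finally show ?thesis .
qed

text \<open>The product form makes \<open>Y j\<close> independent of the family on any subset of
  \<open>D\<close>, given \<open>X\<close>. Diminishing returns then apply with \<open>f\<close> the
  restriction from \<open>D\<close> to \<open>C\<close>.\<close>

lemma (in information_space) mutual_information_family_submodular:
  assumes I: "finite I" and X: "simple_function M X"
    and Y: "\<And>i. i \<in> I \<Longrightarrow> simple_function M (Y i)"
    and fact: "\<And>x y. \<P>(\<omega> in M. X \<omega> = x \<and> (\<forall>i\<in>I. Y i \<omega> = y i)) = g x * (\<Prod>i\<in>I. h i x (y i))"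
    and CD: "C \<subseteq> D" "D \<subseteq> I" and j: "j \<in> I - D"
  shows "\<I>(X ; \<lambda>\<omega>. \<lambda>i\<in>D \<union> {j}. Y i \<omega>) - \<I>(X ; \<lambda>\<omega>. \<lambda>i\<in>D. Y i \<omega>) \<le>
    \<I>(X ; \<lambda>\<omega>. \<lambda>i\<in>C \<union> {j}. Y i \<omega>) - \<I>(X ; \<lambda>\<omega>. \<lambda>i\<in>C. Y i \<omega>)"
proof -
  let ?F = "\<lambda>J \<omega>. \<lambda>i\<in>J. Y i \<omega>"
  have F: "simple_function M (?F J)" if "J \<subseteq> I" for J
    using that Y by (intro simple_function_family) (auto intro: finite_subset[OF _ I])
  have Yj: "simple_function M (Y j)" using j Y by simp
  have indep: "\<I>(Y j ; ?F J | X) = 0" if J: "J \<subseteq> D" for J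
  proof (rule conditional_mutual_information_eq_0[OF Yj F X])
    show "J \<subseteq> I" using J CD by auto
    have sub: "J \<subseteq> I" "{j} \<subseteq> I" "insert j J \<subseteq> I" "j \<notin> J" "finite J"
      using J CD j I by (auto intro: finite_subset)
    fix v c x
    show "\<P>(\<omega> in M. Y j \<omega> = v \<and> ?F J \<omega> = c \<and> X \<omega> = x) * \<P>(\<omega> in M. X \<omega> = x) =
        \<P>(\<omega> in M. Y j \<omega> = v \<and> X \<omega> = x) * \<P>(\<omega> in M. ?F J \<omega> = c \<and> X \<omega> = x)"
    \<comment> \<open>A family is always extensional, so for other \<open>c\<close> the events
      involving it are empty and both sides are 0.\<close>
    proof (cases "c \<in> extensional J")
      case False
      then have "?F J \<omega> \<noteq> c" for \<omega>
        by (metis restrict_extensional)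
      then show ?thesis by simp
    next
      case True
      then have Fc: "?F J \<omega> = c \<longleftrightarrow> (\<forall>i\<in>J. Y i \<omega> = c i)" for \<omega>
        by (rule restrict_eq_iff)
      \<comment> \<open>One assignment carrying both \<open>c\<close> and \<open>v\<close>, so that
        all four events are instances of \<open>m\<close>, with index sets
        \<open>insert j J\<close>, \<open>{}\<close>, \<open>{j}\<close> and
        \<open>J\<close>.\<close>
      define y where "y = c(j := v)"
      define K where "K i = (\<Sum>u\<in>Y i ` space M. h i x u)" for i
      have m: "\<P>(\<omega> in M. X \<omega> = x \<and> (\<forall>i\<in>L. Y i \<omega> = y i)) =
          g x * (\<Prod>i\<in>L. h i x (y i)) * (\<Prod>i\<in>I - L. K i)" if "L \<subseteq> I" for L
        unfolding K_def by (rule marginal_of_product_form[OF I X Y fact that])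
      have yJ: "y i = c i" if "i \<in> J" for i
        using that sub by (auto simp: y_def)
      have "\<P>(\<omega> in M. Y j \<omega> = v \<and> ?F J \<omega> = c \<and> X \<omega> = x) =
          \<P>(\<omega> in M. X \<omega> = x \<and> (\<forall>i\<in>insert j J. Y i \<omega> = y i))"
        using yJ by (intro arg_cong[where f=prob]) (auto simp: Fc y_def)
      moreover have "\<P>(\<omega> in M. X \<omega> = x) = \<P>(\<omega> in M. X \<omega> = x \<and> (\<forall>i\<in>{}. Y i \<omega> = y i))"
        by simp
      moreover have "\<P>(\<omega> in M. Y j \<omega> = v \<and> X \<omega> = x) =
          \<P>(\<omega> in M. X \<omega> = x \<and> (\<forall>i\<in>{j}. Y i \<omega> = y i))"
        by (intro arg_cong[where f=prob]) (auto simp: y_def)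
      moreover have "\<P>(\<omega> in M. ?F J \<omega> = c \<and> X \<omega> = x) =
          \<P>(\<omega> in M. X \<omega> = x \<and> (\<forall>i\<in>J. Y i \<omega> = y i))"
        using yJ by (intro arg_cong[where f=prob]) (auto simp: Fc)
      \<comment> \<open>Splitting the masses along \<open>J\<close>, \<open>{j}\<close> and the rest
        shows that both sides of the independence equation carry the same factors
        \<open>K\<close>.\<close>
      moreover have "prod K (I - {}) = prod K J * (K j * prod K (I - insert j J))"
        "prod K (I - {j}) = prod K J * prod K (I - insert j J)"
        "prod K (I - J) = K j * prod K (I - insert j J)"
      proof -
        have eq: "I - {} = J \<union> insert j (I - insert j J)"  "I - {j} = J \<union> (I - insert j J)"
          "I - J = insert j (I - insert j J)"
          using sub j by auto
        have "prod K (J \<union> insert j (I - insert j J)) = prod K J * prod K (insert j (I - insert j J))"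
          "prod K (J \<union> (I - insert j J)) = prod K J * prod K (I - insert j J)"
          using sub I by (intro prod.union_disjoint; auto)+
        then show "prod K (I - {}) = prod K J * (K j * prod K (I - insert j J))"
          "prod K (I - {j}) = prod K J * prod K (I - insert j J)"
          "prod K (I - J) = K j * prod K (I - insert j J)"
          unfolding eq using I by simp_all
      qed
      ultimately show ?thesis
        using m[OF sub(1)] m[OF sub(2)] m[OF sub(3)] m[of "{}"] sub by simp
    qed
  qed
  \<comment> \<open>The family on \<open>J\<close> enlarged by \<open>j\<close> and the pair of
    \<open>Y j\<close> with the family on \<open>J\<close> determine each other, so their mutual
    information with \<open>X\<close> agrees.\<close>
  have join: "\<I>(X ; ?F (J \<union> {j})) = \<I>(X ; \<lambda>\<omega>. (Y j \<omega>, ?F J \<omega>))" if J: "J \<subseteq> D" for J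
  proof -
    have sub: "J \<union> {j} \<subseteq> I" using J CD j by auto
    have eq: "(\<lambda>\<omega>. (Y j \<omega>, ?F J \<omega>)) = (\<lambda>\<omega>. (\<lambda>w. (w j, restrict w J)) (?F (J \<union> {j}) \<omega>))"
      by (auto simp: fun_eq_iff restrict_def)
    have inj: "inj_on (\<lambda>w. (w j, restrict w J)) (?F (J \<union> {j}) ` space M)"
    proof (rule inj_onI)
      fix u w assume uw: "u \<in> ?F (J \<union> {j}) ` space M" "w \<in> ?F (J \<union> {j}) ` space M"
        and eq: "(u j, restrict u J) = (w j, restrict w J)"
      have "u i = w i" if "i \<in> J \<union> {j}" for i
        using that arg_cong[OF eq, of "\<lambda>p. (fst p, snd p i)"] by auto
      with uw show "u = w"
        by (intro extensionalityI[of u "J \<union> {j}" w]) auto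
    qed
    show ?thesis
      unfolding eq by (rule mutual_information_inj[OF X F[OF sub] inj, symmetric])
  qed
  have FC: "restrict (?F D \<omega>) C = ?F C \<omega>" for \<omega>
    using CD by (auto simp: fun_eq_iff restrict_def)
  have "\<I>(X ; \<lambda>\<omega>. (Y j \<omega>, ?F D \<omega>)) - \<I>(X ; ?F D) \<le>
      \<I>(X ; \<lambda>\<omega>. (Y j \<omega>, restrict (?F D \<omega>) C)) - \<I>(X ; \<lambda>\<omega>. restrict (?F D \<omega>) C)"
    by (rule mutual_information_diminishing_returns[OF X Yj F[OF CD(2)] indep[OF order_refl]])
      (unfold FC, rule indep[OF CD(1)])
  then show ?thesis
    unfolding join[OF CD(1)] join[OF order_refl] FC .
qed

subsection \<open>Law of the induced process\<close>

text \<open>The process prescribes conditional laws only after histories of positive probability. If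
  \<open>Q\<close> is null, both sides are 0, so the multiplied form holds for every
  history.\<close>

lemma (in prob_space) prob_conj_eq_cond:
  assumes "0 < \<P>(\<omega> in M. Q \<omega>) \<Longrightarrow> \<P>(\<omega> in M. R \<omega> \<bar> Q \<omega>) = c"
    and "{\<omega> \<in> space M. Q \<omega>} \<in> events"
  shows "\<P>(\<omega> in M. Q \<omega> \<and> R \<omega>) = \<P>(\<omega> in M. Q \<omega>) * c"
proof (cases "0 < \<P>(\<omega> in M. Q \<omega>)")
  case True
  then show ?thesis
    using assms(1) by (auto simp: cond_prob_def field_simps conj_commute)
next
  case False
  then have 0: "\<P>(\<omega> in M. Q \<omega>) = 0"
    by (simp add: zero_less_measure_iff)
  have "\<P>(\<omega> in M. Q \<omega> \<and> R \<omega>) \<le> \<P>(\<omega> in M. Q \<omega>)"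
    using assms(2) by (intro finite_measure_mono) auto
  then show ?thesis
    using 0 by (simp add: measure_le_0_iff)
qed

section \<open>The induced process and its measurability\<close>

locale policy_process =
  fixes M :: "('e \<times> (nat \<Rightarrow> 'l), 'a, 'o) dec_pomdp"
    and \<pi> :: "nat \<Rightarrow> ('o, 'a) local_policy"
    and \<Omega> :: "'w measure"
    and S :: "nat \<Rightarrow> 'w \<Rightarrow> 'e \<times> (nat \<Rightarrow> 'l)"
    and Ob :: "nat \<Rightarrow> nat \<Rightarrow> 'w \<Rightarrow> 'o"
    and A :: "nat \<Rightarrow> nat \<Rightarrow> 'w \<Rightarrow> 'a"
  assumes pomdp: "is_dec_pomdp M"
    and process: "induced_process M \<pi> \<Omega> S Ob A"
    and factored: "factored_dec_pomdp M"
    and cond_indep: "cond_indep_observations M \<Omega> S Ob A"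

sublocale policy_process \<subseteq> prob_space \<Omega>
  using process unfolding induced_process_def by (rule conjunct1)

context policy_process
begin

abbreviation "T \<equiv> horizon M"
abbreviation "N \<equiv> agents M"

lemma finite_agents [simp]: "finite N"
  by (simp add: agents_def)

lemmas process_laws = process[unfolded induced_process_def, THEN conjunct2]
lemmas measurable_laws = process_laws[THEN conjunct1]
  process_laws[THEN conjunct2, THEN conjunct1]
  process_laws[THEN conjunct2, THEN conjunct2, THEN conjunct1]
lemmas transition_laws = process_laws[THEN conjunct2, THEN conjunct2, THEN conjunct2]
lemmas init_law = transition_laws[THEN conjunct1, rule_format]
lemmas emission_law = transition_laws[THEN conjunct2, THEN conjunct1, rule_format]
lemmas action_law = transition_laws[THEN conjunct2, THEN conjunct2, THEN conjunct1, rule_format]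
lemmas state_law = transition_laws[THEN conjunct2, THEN conjunct2, THEN conjunct2, rule_format]

lemma measurable_process:
  "t \<le> T \<Longrightarrow> S t \<in> measurable \<Omega> (count_space (states M))"
  "i \<in> N \<Longrightarrow> t \<le> T \<Longrightarrow> Ob i t \<in> measurable \<Omega> (count_space (observations M i))"
  "i \<in> N \<Longrightarrow> t < T \<Longrightarrow> A i t \<in> measurable \<Omega> (count_space (actions M i))"
  using measurable_laws by blast+

lemma simple_process:
  "t \<le> T \<Longrightarrow> simple_function \<Omega> (S t)"
  "i \<in> N \<Longrightarrow> t \<le> T \<Longrightarrow> simple_function \<Omega> (Ob i t)"
  "i \<in> N \<Longrightarrow> t < T \<Longrightarrow> simple_function \<Omega> (A i t)"
  using pomdp unfolding is_dec_pomdp_def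
  by (auto intro: simple_function_measurable_finite[OF measurable_process(1)]
      simple_function_measurable_finite[OF measurable_process(2)]
      simple_function_measurable_finite[OF measurable_process(3)])

lemma events_process:
  "t \<le> T \<Longrightarrow> {\<omega> \<in> space \<Omega>. S t \<omega> = x} \<in> events"
  "i \<in> N \<Longrightarrow> t \<le> T \<Longrightarrow> {\<omega> \<in> space \<Omega>. Ob i t \<omega> = y} \<in> events"
  "i \<in> N \<Longrightarrow> t < T \<Longrightarrow> {\<omega> \<in> space \<Omega>. A i t \<omega> = z} \<in> events"
  using simple_process by (auto intro: simple_function_Collect)

lemma process_in:
  assumes "\<omega> \<in> space \<Omega>"
  shows "t \<le> T \<Longrightarrow> S t \<omega> \<in> states M"
    and "i \<in> N \<Longrightarrow> t \<le> T \<Longrightarrow> Ob i t \<omega> \<in> observations M i"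
    and "i \<in> N \<Longrightarrow> t < T \<Longrightarrow> A i t \<omega> \<in> actions M i"
  using measurable_space[OF measurable_process(1) assms] measurable_space[OF measurable_process(2) assms]
    measurable_space[OF measurable_process(3) assms] by auto

lemma events_past:
  assumes "t \<le> T"
  shows "{\<omega> \<in> space \<Omega>. past_is M S Ob A s ob a t \<omega>} \<in> events"
proof -
  have "{\<omega> \<in> space \<Omega>. \<forall>k\<in>{..<t}. S k \<omega> = s k \<and> (\<forall>i\<in>N. Ob i k \<omega> = ob i k \<and> A i k \<omega> = a i k)} \<in> events"
    using assms by (intro sets.sets_Collect_finite_All sets.sets_Collect_conj) (simp_all add: events_process)
  moreover have "past_is M S Ob A s ob a t \<omega> \<longleftrightarrow>
      (\<forall>k\<in>{..<t}. S k \<omega> = s k \<and> (\<forall>i\<in>N. Ob i k \<omega> = ob i k \<and> A i k \<omega> = a i k))" for \<omega>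
    unfolding past_is_def by auto
  ultimately show ?thesis by (simp only:)
qed

section \<open>One-step laws of the history\<close>

text \<open>The history up to time \<open>t\<close> with the state and observations at
  \<open>t\<close> but not the actions at \<open>t\<close>. At \<open>t = T\<close> this is the full
  trajectory whose law is determined, since the actions at time \<open>T\<close> are
  unconstrained.\<close>

definition obs_path where
  "obs_path s ob a t \<omega> \<longleftrightarrow>
    past_is M S Ob A s ob a t \<omega> \<and> S t \<omega> = s t \<and> (\<forall>i\<in>N. Ob i t \<omega> = ob i t)"

lemma events_obs_path:
  "t \<le> T \<Longrightarrow> {\<omega> \<in> space \<Omega>. obs_path s ob a t \<omega>} \<in> events"
  unfolding obs_path_def
  by (intro sets.sets_Collect_finite_All sets.sets_Collect_conj)
    (simp_all add: events_process events_past)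

lemma past_is_Suc:
  "past_is M S Ob A s ob a (Suc t) \<omega> \<longleftrightarrow> obs_path s ob a t \<omega> \<and> (\<forall>i\<in>N. A i t \<omega> = a i t)"
  unfolding past_is_def obs_path_def by (auto simp: less_Suc_eq)

text \<open>Conditional independence turns the joint law of the observations into the product of the
  single emission laws. Together with \<open>prob_act\<close> and \<open>prob_trans\<close> this
  gives a recursion through observations, actions and next state.\<close>

lemma prob_obs:
  assumes "t \<le> T"
  shows "\<P>(\<omega> in \<Omega>. obs_path s ob a t \<omega>) =
    \<P>(\<omega> in \<Omega>. past_is M S Ob A s ob a t \<omega> \<and> S t \<omega> = s t) *
    (\<Prod>i\<in>N. pmf (emission M i (s t)) (ob i t))"
proof -
  have "\<P>(\<omega> in \<Omega>. (past_is M S Ob A s ob a t \<omega> \<and> S t \<omega> = s t) \<and> (\<forall>i\<in>N. Ob i t \<omega> = ob i t)) =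
    \<P>(\<omega> in \<Omega>. past_is M S Ob A s ob a t \<omega> \<and> S t \<omega> = s t) *
    (\<Prod>i\<in>N. pmf (emission M i (s t)) (ob i t))"
  proof (rule prob_conj_eq_cond)
    assume pos: "0 < \<P>(\<omega> in \<Omega>. past_is M S Ob A s ob a t \<omega> \<and> S t \<omega> = s t)"
    then have "\<P>(\<omega> in \<Omega>. \<forall>i\<in>N. Ob i t \<omega> = ob i t \<bar> past_is M S Ob A s ob a t \<omega> \<and> S t \<omega> = s t) =
      (\<Prod>i\<in>N. \<P>(\<omega> in \<Omega>. Ob i t \<omega> = ob i t \<bar> past_is M S Ob A s ob a t \<omega> \<and> S t \<omega> = s t))"
      using cond_indep[unfolded cond_indep_observations_def, rule_format, OF assms] by simp
    also have "\<dots> = (\<Prod>i\<in>N. pmf (emission M i (s t)) (ob i t))"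
      by (intro prod.cong refl emission_law[OF assms pos])
    finally show "\<P>(\<omega> in \<Omega>. \<forall>i\<in>N. Ob i t \<omega> = ob i t \<bar> past_is M S Ob A s ob a t \<omega> \<and> S t \<omega> = s t) =
      (\<Prod>i\<in>N. pmf (emission M i (s t)) (ob i t))" .
  qed (use assms in \<open>intro sets.sets_Collect_conj, simp_all add: events_process events_past\<close>)
  then show ?thesis
    unfolding obs_path_def by (simp only: conj_assoc)
qed

lemma prob_act:
  assumes "t < T"
  shows "\<P>(\<omega> in \<Omega>. past_is M S Ob A s ob a (Suc t) \<omega>) = \<P>(\<omega> in \<Omega>. obs_path s ob a t \<omega>) *
    (\<Prod>i\<in>N. pmf (\<pi> i (map (ob i) [0..<Suc t]) (map (a i) [0..<t])) (a i t))"
  unfolding past_is_Suc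
proof (rule prob_conj_eq_cond)
  assume "0 < \<P>(\<omega> in \<Omega>. obs_path s ob a t \<omega>)"
  then show "\<P>(\<omega> in \<Omega>. \<forall>i\<in>N. A i t \<omega> = a i t \<bar> obs_path s ob a t \<omega>) =
      (\<Prod>i\<in>N. pmf (\<pi> i (map (ob i) [0..<Suc t]) (map (a i) [0..<t])) (a i t))"
    unfolding obs_path_def by (rule action_law[OF assms])
qed (use assms in \<open>simp add: events_obs_path\<close>)

lemma prob_trans:
  assumes "t < T"
  shows "\<P>(\<omega> in \<Omega>. past_is M S Ob A s ob a (Suc t) \<omega> \<and> S (Suc t) \<omega> = s (Suc t)) =
    \<P>(\<omega> in \<Omega>. past_is M S Ob A s ob a (Suc t) \<omega>) *
    pmf (trans_fn M (s t) (\<lambda>i\<in>N. a i t)) (s (Suc t))"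
proof (rule prob_conj_eq_cond)
  assume "0 < \<P>(\<omega> in \<Omega>. past_is M S Ob A s ob a (Suc t) \<omega>)"
  then show "\<P>(\<omega> in \<Omega>. S (Suc t) \<omega> = s (Suc t) \<bar> past_is M S Ob A s ob a (Suc t) \<omega>) =
      pmf (trans_fn M (s t) (\<lambda>i\<in>N. a i t)) (s (Suc t))"
    by (rule state_law[OF assms])
qed (use assms in \<open>simp add: events_past\<close>)

section \<open>Product form of the trajectory law\<close>

text \<open>Induction on time: every one-step law is an environment factor times a product over
  agents, and agent \<open>i\<close> contributes only terms in \<open>x\<close> and its own
  trajectory. Values are confined to \<open>states M\<close> and \<open>actions M i\<close> because
  the transition law is assumed to factor only there.\<close>

lemma obs_path_product_form:
  obtains G F where
    "\<forall>x l ob a. (\<forall>k\<le>T. (x k, l k) \<in> states M) \<longrightarrow>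
      (\<forall>i\<in>N. \<forall>k<T. a i k \<in> actions M i) \<longrightarrow>
      \<P>(\<omega> in \<Omega>. obs_path (\<lambda>k. (x k, l k)) ob a T \<omega>) =
        G x * (\<Prod>i\<in>N. F i x (\<lambda>k. l k i) (ob i) (a i))"
proof -
  obtain Pe Pl \<mu>e \<mu>l where
    tr: "\<forall>(x, y)\<in>states M. \<forall>(x', y')\<in>states M. \<forall>c\<in>joint_actions M.
      pmf (trans_fn M (x, y) c) (x', y') = pmf (Pe x) x' * (\<Prod>i\<in>N. pmf (Pl i (y i) (c i)) (y' i))"
    and ini: "\<forall>(x, y)\<in>states M.
      pmf (init_dist M) (x, y) = pmf \<mu>e x * (\<Prod>i\<in>N. pmf (\<mu>l i) (y i))"
    using factored unfolding factored_dec_pomdp_def by (elim conjE exE) (rule that)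
  have trans: "pmf (trans_fn M (x, y) c) (x', y') =
      pmf (Pe x) x' * (\<Prod>i\<in>N. pmf (Pl i (y i) (c i)) (y' i))"
    if "(x, y) \<in> states M" "(x', y') \<in> states M" "c \<in> joint_actions M" for x y x' y' c
    using bspec[OF bspec[OF tr that(1), unfolded prod.case] that(2), unfolded prod.case] that(3)
    by (rule bspec)
  have init: "pmf (init_dist M) (x, y) = pmf \<mu>e x * (\<Prod>i\<in>N. pmf (\<mu>l i) (y i))"
    if "(x, y) \<in> states M" for x y
    using bspec[OF ini that] by (simp only: prod.case)
  have em: "\<forall>i\<in>N. \<forall>(x, y)\<in>states M. \<forall>(x', y')\<in>states M.
      x = x' \<and> y i = y' i \<longrightarrow> emission M i (x, y) = emission M i (x', y')"
    using factored unfolding factored_dec_pomdp_def by (rule conjunct2)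
  have emit: "emission M i (x, y) = emission M i (x, y')"
    if "i \<in> N" "(x, y) \<in> states M" "(x, y') \<in> states M" "y i = y' i" for i x y y'
    using bspec[OF bspec[OF bspec[OF em that(1)] that(2), unfolded prod.case] that(3), unfolded prod.case]
      that(4) by simp
  \<comment> \<open>\<open>E\<^sub>i\<close> as a function of \<open>(s\<^sub>e, s\<^sub>i)\<close>: any state with these components serves.\<close>
  define e where "e i x u = emission M i (SOME s. s \<in> states M \<and> fst s = x \<and> snd s i = u)" for i x u
  have e: "emission M i (x, y) = e i x (y i)" if "i \<in> N" "(x, y) \<in> states M" for i x y
  proof -
    let ?s = "SOME s. s \<in> states M \<and> fst s = x \<and> snd s i = y i"
    have "?s \<in> states M \<and> fst ?s = x \<and> snd ?s i = y i"
      by (rule someI[of _ "(x, y)"]) (use that in simp)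
    then show ?thesis
      unfolding e_def using emit[of i x y "snd ?s"] that by (cases ?s) auto
  qed
  \<comment> \<open>\<open>G\<close> collects the environment's initial law and transitions;
    \<open>F\<close> collects what agent \<open>i\<close> adds: its initial law, its policy and
    local transitions at times \<open>k < t\<close>, and its emissions at times up to and including
    \<open>t\<close>.\<close>
  define G where "G t x = pmf \<mu>e (x 0) * (\<Prod>k<t. pmf (Pe (x k)) (x (Suc k)))" for t x
  define F where "F t i x l ob a = pmf (\<mu>l i) (l 0) *
    (\<Prod>k<t. pmf (\<pi> i (map ob [0..<Suc k]) (map a [0..<k])) (a k) * pmf (Pl i (l k) (a k)) (l (Suc k))) *
    (\<Prod>k\<le>t. pmf (e i (x k) (l k)) (ob k))" for t i x l ob a
  have path: "\<P>(\<omega> in \<Omega>. obs_path (\<lambda>k. (x k, l k)) ob a t \<omega>) =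
      G t x * (\<Prod>i\<in>N. F t i x (\<lambda>k. l k i) (ob i) (a i))"
    if st: "\<And>k. k \<le> T \<Longrightarrow> (x k, l k) \<in> states M"
      and act: "\<And>i k. i \<in> N \<Longrightarrow> k < T \<Longrightarrow> a i k \<in> actions M i"
      and "t \<le> T" for t x l ob a
    using \<open>t \<le> T\<close>
  proof (induction t)
    case 0
    have "\<P>(\<omega> in \<Omega>. obs_path (\<lambda>k. (x k, l k)) ob a 0 \<omega>) =
        pmf (init_dist M) (x 0, l 0) * (\<Prod>i\<in>N. pmf (emission M i (x 0, l 0)) (ob i 0))"
      unfolding prob_obs[OF le0] using init_law[OF st[OF le0]] by (simp add: past_is_def)
    then show ?case
      using st[OF le0] by (simp add: init e prod.distrib F_def G_def)
  next
    case (Suc t)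
    then have t: "t < T" "t \<le> T" "Suc t \<le> T" by auto
    \<comment> \<open>Joint actions are extensional, and it is the restricted function that occurs
      in the transition law.\<close>
    have "(\<lambda>i\<in>N. a i t) \<in> joint_actions M"
      unfolding joint_actions_def using act t by auto
    then have "pmf (trans_fn M (x t, l t) (\<lambda>i\<in>N. a i t)) (x (Suc t), l (Suc t)) =
        pmf (Pe (x t)) (x (Suc t)) * (\<Prod>i\<in>N. pmf (Pl i (l t i) (a i t)) (l (Suc t) i))"
      using trans[OF st[OF t(2)] st[OF t(3)]] by simp
    moreover have "(\<Prod>i\<in>N. pmf (emission M i (x (Suc t), l (Suc t))) (ob i (Suc t))) =
        (\<Prod>i\<in>N. pmf (e i (x (Suc t)) (l (Suc t) i)) (ob i (Suc t)))"
      using e st[OF t(3)] by simp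
    ultimately show ?case
      unfolding prob_obs[OF t(3)] prob_trans[OF t(1), of "\<lambda>k. (x k, l k)" ob a] prob_act[OF t(1)]
        Suc.IH[OF t(2)]
      by (simp add: F_def G_def prod.distrib mult_ac del: upt_Suc)
  qed
  show thesis
    by (rule that[of "G T" "F T"]) (intro allI impI path, simp_all)
qed

section \<open>From trajectories to environment and observation sequences\<close>

lemma obs_path_iff:
  "obs_path s ob a t \<omega> \<longleftrightarrow>
    (\<forall>k\<le>t. S k \<omega> = s k \<and> (\<forall>i\<in>N. Ob i k \<omega> = ob i k)) \<and> (\<forall>k<t. \<forall>i\<in>N. A i k \<omega> = a i k)"
  unfolding obs_path_def past_is_def by (auto simp: le_less)

lemma env_sequence_eq_iff:
  "length xs = Suc t \<Longrightarrow> env_sequence t S \<omega> = xs \<longleftrightarrow> (\<forall>k\<le>t. fst (S k \<omega>) = xs ! k)"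
  unfolding env_sequence_def
  by (auto simp: list_eq_iff_nth_eq less_Suc_eq_le simp del: upt_Suc)

lemma obs_sequence_eq_iff:
  "length ys = Suc t \<Longrightarrow> obs_sequence t Ob i \<omega> = ys \<longleftrightarrow> (\<forall>k\<le>t. Ob i k \<omega> = ys ! k)"
  unfolding obs_sequence_def
  by (auto simp: list_eq_iff_nth_eq less_Suc_eq_le simp del: upt_Suc)

lemma length_sequences:
  "length (env_sequence t S \<omega>) = Suc t" "length (obs_sequence t Ob i \<omega>) = Suc t"
  by (simp_all add: env_sequence_def obs_sequence_def)

text \<open>The list is a function of the finite family of states at times up to \<open>T\<close>.
  The restriction to \<open>{..T}\<close> matters, as measurability is given only at these
  times.\<close>

lemma simple_env_sequence: "simple_function \<Omega> (env_sequence T S)"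
proof -
  have "simple_function \<Omega> (\<lambda>\<omega>. \<lambda>t\<in>{..T}. S t \<omega>)"
    by (intro simple_function_family simple_process) auto
  then have "simple_function \<Omega> (\<lambda>\<omega>. map (\<lambda>t. fst ((\<lambda>t\<in>{..T}. S t \<omega>) t)) [0..<Suc T])"
    by (rule simple_function_compose1)
  moreover have "map (\<lambda>t. fst ((\<lambda>t\<in>{..T}. S t \<omega>) t)) [0..<Suc T] = env_sequence T S \<omega>" for \<omega>
    unfolding env_sequence_def by (rule map_cong) auto
  ultimately show ?thesis by simp
qed

lemma simple_obs_sequence:
  assumes "i \<in> N"
  shows "simple_function \<Omega> (obs_sequence T Ob i)"
proof -
  have "simple_function \<Omega> (\<lambda>\<omega>. \<lambda>t\<in>{..T}. Ob i t \<omega>)"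
    using assms by (intro simple_function_family simple_process) auto
  then have "simple_function \<Omega> (\<lambda>\<omega>. map (\<lambda>t\<in>{..T}. Ob i t \<omega>) [0..<Suc T])"
    by (rule simple_function_compose1)
  moreover have "map (\<lambda>t\<in>{..T}. Ob i t \<omega>) [0..<Suc T] = obs_sequence T Ob i \<omega>" for \<omega>
    unfolding obs_sequence_def by (rule map_cong) auto
  ultimately show ?thesis by simp
qed

text \<open>The projection of the state set to coordinate \<open>i\<close>. It is finite because
  \<open>states M\<close> is, and it avoids carrying the existentially quantified factors of the
  state set.\<close>

definition local_states where
  "local_states i = (\<lambda>s. snd s i) ` states M"

text \<open>The state set is a product, so components taken from different joint states can be
  recombined.\<close>

lemma states_rectangular:
  assumes "x \<in> fst ` states M" "\<And>i. i \<in> N \<Longrightarrow> v i \<in> local_states i"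
  shows "(x, restrict v N) \<in> states M"
proof -
  obtain Se Sl where st: "states M = Se \<times> (\<Pi>\<^sub>E i\<in>N. Sl i)"
    using factored unfolding factored_dec_pomdp_def by (elim conjE exE)
  have "v i \<in> Sl i" if "i \<in> N" for i
    using assms(2)[OF that] that unfolding local_states_def st by auto
  then show ?thesis
    using assms(1) unfolding st by (auto split: if_splits)
qed

lemma states_extensional: "s \<in> states M \<Longrightarrow> snd s \<in> extensional N"
  using factored unfolding factored_dec_pomdp_def by (elim conjE exE) (auto simp: PiE_def)

text \<open>The trajectory law is summed over the unobserved local states and actions. These range
  over a product of one finite set per agent, so the sum of products becomes a product of
  sums.\<close>

lemma env_obs_product_form:
  obtains g h where
    "\<forall>x y. \<P>(\<omega> in \<Omega>. env_sequence T S \<omega> = x \<and> (\<forall>i\<in>N. obs_sequence T Ob i \<omega> = y i)) =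
      g x * (\<Prod>i\<in>N. h i x (y i))"
proof -
  obtain G F where path: "\<forall>x l ob a. (\<forall>k\<le>T. (x k, l k) \<in> states M) \<longrightarrow>
      (\<forall>i\<in>N. \<forall>k<T. a i k \<in> actions M i) \<longrightarrow>
      \<P>(\<omega> in \<Omega>. obs_path (\<lambda>k. (x k, l k)) ob a T \<omega>) =
        G x * (\<Prod>i\<in>N. F i x (\<lambda>k. l k i) (ob i) (a i))"
    by (rule obs_path_product_form)
  \<comment> \<open>The possible hidden trajectories of agent \<open>i\<close>: local states at
    times 0 to \<open>T\<close>, and actions only at times before \<open>T\<close>. Below,
    \<open>R\<close> is the random family of these trajectories.\<close>
  define B where "B i = ({..T} \<rightarrow>\<^sub>E local_states i) \<times> ({..<T} \<rightarrow>\<^sub>E actions M i)" for i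
  have fin: "finite (B i)" if "i \<in> N" for i
    using that pomdp unfolding B_def is_dec_pomdp_def local_states_def
    by (intro finite_cartesian_product finite_PiE) auto
  define R where "R \<omega> = (\<lambda>i\<in>N. (\<lambda>k\<in>{..T}. snd (S k \<omega>) i, \<lambda>k\<in>{..<T}. A i k \<omega>))" for \<omega>
  have R: "R \<omega> \<in> Pi\<^sub>E N B" if "\<omega> \<in> space \<Omega>" for \<omega>
    using process_in[OF that] unfolding R_def B_def local_states_def by auto
  \<comment> \<open>The value 0 is given to lists that cannot occur, of wrong length or with entries
    outside the environment states, so that the formula holds for all \<open>x\<close> and
    \<open>y\<close>.\<close>
  define g where "g x = (if length x = Suc T \<and> set x \<subseteq> fst ` states M then G (nth x) else 0)" for x
  define h where "h i x y = (if length y = Suc T then \<Sum>r\<in>B i. F i (nth x) (fst r) (nth y) (snd r) else 0)"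
    for i x y
  have "\<P>(\<omega> in \<Omega>. env_sequence T S \<omega> = x \<and> (\<forall>i\<in>N. obs_sequence T Ob i \<omega> = y i)) =
      g x * (\<Prod>i\<in>N. h i x (y i))" for x y
  proof (cases "length x = Suc T \<and> set x \<subseteq> fst ` states M \<and> (\<forall>i\<in>N. length (y i) = Suc T)")
    case False
    have "env_sequence T S \<omega> = x \<Longrightarrow> length x = Suc T \<and> set x \<subseteq> fst ` states M" if "\<omega> \<in> space \<Omega>" for \<omega>
      using process_in(1)[OF that] length_sequences(1)[of T \<omega>]
      by (auto simp: env_sequence_def less_Suc_eq_le simp del: upt_Suc)
    moreover have "(\<forall>i\<in>N. obs_sequence T Ob i \<omega> = y i) \<Longrightarrow> \<forall>i\<in>N. length (y i) = Suc T" for \<omega>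
      using length_sequences(2)[of T _ \<omega>] by metis
    ultimately have empty: "{\<omega> \<in> space \<Omega>. env_sequence T S \<omega> = x \<and> (\<forall>i\<in>N. obs_sequence T Ob i \<omega> = y i)} = {}"
      using False by blast
    have "g x * (\<Prod>i\<in>N. h i x (y i)) = 0"
      using False by (auto simp: g_def h_def)
    then show ?thesis unfolding empty by simp
  next
    case True
    then have lenx: "length x = Suc T" and setx: "set x \<subseteq> fst ` states M"
      and leny: "\<And>i. i \<in> N \<Longrightarrow> length (y i) = Suc T" by auto
    let ?Q = "\<lambda>\<omega>. env_sequence T S \<omega> = x \<and> (\<forall>i\<in>N. obs_sequence T Ob i \<omega> = y i)"
    \<comment> \<open>Reassembles the local states at time \<open>k\<close> into the extensional
      function that forms the second component of a joint state.\<close>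
    let ?l = "\<lambda>r k. \<lambda>i\<in>N. fst (r i) k"
    let ?path = "\<lambda>r. obs_path (\<lambda>k. (x ! k, ?l r k)) (\<lambda>i. nth (y i)) (\<lambda>i. snd (r i)) T"
    have Q: "?Q \<omega> \<longleftrightarrow> (\<forall>k\<le>T. fst (S k \<omega>) = x ! k) \<and> (\<forall>i\<in>N. \<forall>k\<le>T. Ob i k \<omega> = y i ! k)" for \<omega>
      using env_sequence_eq_iff[OF lenx] obs_sequence_eq_iff[OF leny] by auto
    \<comment> \<open>Fixing the two kinds of sequences and the hidden trajectories fixes the whole
      trajectory. Extensionality of states and of the members of \<open>B i\<close> turns the
      equations between functions into pointwise ones.\<close>
    have glue: "?Q \<omega> \<and> R \<omega> = r \<longleftrightarrow> ?path r \<omega>" if \<omega>: "\<omega> \<in> space \<Omega>" and r: "r \<in> Pi\<^sub>E N B" for \<omega> r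
    proof -
      have ext: "fst (r i) \<in> extensional {..T}" "snd (r i) \<in> extensional {..<T}" if "i \<in> N" for i
        using PiE_mem[OF r that] by (auto simp: B_def PiE_def)
      have "R \<omega> = r \<longleftrightarrow> (\<forall>i\<in>N. (\<lambda>k\<in>{..T}. snd (S k \<omega>) i) = fst (r i) \<and> (\<lambda>k\<in>{..<T}. A i k \<omega>) = snd (r i))"
        unfolding R_def using r by (subst restrict_eq_iff) (auto simp: PiE_def prod_eq_iff)
      also have "\<dots> \<longleftrightarrow> (\<forall>i\<in>N. (\<forall>k\<le>T. snd (S k \<omega>) i = fst (r i) k) \<and> (\<forall>k<T. A i k \<omega> = snd (r i) k))"
        using ext by (intro ball_cong refl) (auto simp: restrict_eq_iff)
      finally have "R \<omega> = r \<longleftrightarrow> \<dots>" .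
      moreover have "S k \<omega> = (x ! k, ?l r k) \<longleftrightarrow>
          fst (S k \<omega>) = x ! k \<and> (\<forall>i\<in>N. snd (S k \<omega>) i = fst (r i) k)" if "k \<le> T" for k
      proof -
        have "snd (S k \<omega>) = ?l r k \<longleftrightarrow> (\<forall>i\<in>N. snd (S k \<omega>) i = fst (r i) k)"
          by (rule eq_restrict_iff, rule states_extensional, rule process_in(1)[OF \<omega> that])
        then show ?thesis
          by (simp only: prod_eq_iff fst_conv snd_conv)
      qed
      then have "(\<forall>k\<le>T. S k \<omega> = (x ! k, ?l r k)) \<longleftrightarrow>
          (\<forall>k\<le>T. fst (S k \<omega>) = x ! k \<and> (\<forall>i\<in>N. snd (S k \<omega>) i = fst (r i) k))"
        by (simp only: cong: imp_cong)
      ultimately show ?thesis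
        unfolding Q obs_path_iff by blast
    qed
    have "\<P>(\<omega> in \<Omega>. ?Q \<omega>) = (\<Sum>r\<in>Pi\<^sub>E N B. \<P>(\<omega> in \<Omega>. ?Q \<omega> \<and> R \<omega> = r))"
    proof (rule prob_eq_sum_values)
      show "finite (Pi\<^sub>E N B)"
        using fin by (intro finite_PiE) auto
      show "{\<omega> \<in> space \<Omega>. ?Q \<omega>} \<in> events"
        by (intro sets.sets_Collect_conj sets.sets_Collect_finite_All)
          (simp_all add: simple_function_Collect simple_env_sequence simple_obs_sequence)
      fix r assume "r \<in> Pi\<^sub>E N B"
      then have "{\<omega> \<in> space \<Omega>. ?Q \<omega> \<and> R \<omega> = r} = {\<omega> \<in> space \<Omega>. ?path r \<omega>}"
        using glue by blast
      then show "{\<omega> \<in> space \<Omega>. ?Q \<omega> \<and> R \<omega> = r} \<in> events"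
        using events_obs_path by simp
    qed (rule R)
    also have "\<dots> = (\<Sum>r\<in>Pi\<^sub>E N B. G (nth x) * (\<Prod>i\<in>N. F i (nth x) (fst (r i)) (nth (y i)) (snd (r i))))"
    proof (rule sum.cong[OF refl])
      fix r assume r: "r \<in> Pi\<^sub>E N B"
      have rB: "fst (r i) \<in> {..T} \<rightarrow>\<^sub>E local_states i" "snd (r i) \<in> {..<T} \<rightarrow>\<^sub>E actions M i" if "i \<in> N" for i
        using PiE_mem[OF r that] by (auto simp: B_def)
      have "{\<omega> \<in> space \<Omega>. ?Q \<omega> \<and> R \<omega> = r} = {\<omega> \<in> space \<Omega>. ?path r \<omega>}"
        using glue[OF _ r] by blast
      moreover have "\<P>(\<omega> in \<Omega>. ?path r \<omega>) =
          G (nth x) * (\<Prod>i\<in>N. F i (nth x) (\<lambda>k. ?l r k i) (nth (y i)) (snd (r i)))"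
      proof (rule path[rule_format])
        fix k assume "k \<le> T"
        then show "(x ! k, ?l r k) \<in> states M"
          using setx lenx rB(1) by (intro states_rectangular) (auto intro: PiE_mem)
      qed (use rB(2) in \<open>auto intro: PiE_mem\<close>)
      ultimately show "\<P>(\<omega> in \<Omega>. ?Q \<omega> \<and> R \<omega> = r) =
          G (nth x) * (\<Prod>i\<in>N. F i (nth x) (fst (r i)) (nth (y i)) (snd (r i)))"
        by simp
    qed
    \<comment> \<open>\<open>G\<close> does not depend on \<open>r\<close>, and
      \<open>prod_sum_PiE\<close> exchanges the sum over \<open>r\<close> with the product over
      agents.\<close>
    also have "\<dots> = g x * (\<Prod>i\<in>N. h i x (y i))"
      using lenx setx leny fin
      by (simp add: g_def h_def sum_distrib_left[symmetric] prod_sum_PiE cong: prod.cong)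
    finally show ?thesis .
  qed
  then show thesis by (intro that[of g h]) simp
qed

end

section \<open>Monotonicity and submodularity of the information about the environment\<close>

theorem lemma5:
  fixes M :: "('e \<times> (nat \<Rightarrow> 'l), 'a, 'o) dec_pomdp"
    and \<pi> :: "nat \<Rightarrow> ('o, 'a) local_policy"
    and \<Omega> :: "'w measure"
    and S :: "nat \<Rightarrow> 'w \<Rightarrow> 'e \<times> (nat \<Rightarrow> 'l)"
    and Ob :: "nat \<Rightarrow> nat \<Rightarrow> 'w \<Rightarrow> 'o"
    and A :: "nat \<Rightarrow> nat \<Rightarrow> 'w \<Rightarrow> 'a"
    and b :: real
  assumes "b > 1"
    and "is_dec_pomdp M"
    and "is_joint_policy M \<pi>"
    and "induced_process M \<pi> \<Omega> S Ob A"
    and "factored_dec_pomdp M"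
    and "cond_indep_observations M \<Omega> S Ob A"
  shows "(\<forall>C D. C \<subseteq> D \<and> D \<subseteq> agents M \<longrightarrow>
            env_info b M \<Omega> S Ob C \<le> env_info b M \<Omega> S Ob D) \<and>
         (\<forall>C D j. C \<subseteq> D \<and> D \<subseteq> agents M \<and> j \<in> agents M - D \<longrightarrow>
            env_info b M \<Omega> S Ob (C \<union> {j}) - env_info b M \<Omega> S Ob C
              \<ge> env_info b M \<Omega> S Ob (D \<union> {j}) - env_info b M \<Omega> S Ob D)"
proof -
  interpret policy_process M \<pi> \<Omega> S Ob A
    using assms by unfold_locales
  interpret information_space \<Omega> b
    using assms(1) by unfold_locales
  let ?X = "env_sequence (horizon M) S" and ?Y = "obs_sequence (horizon M) Ob"
  let ?F = "\<lambda>C \<omega>. \<lambda>i\<in>C. ?Y i \<omega>"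
  let ?I = "\<lambda>V. mutual_information b (count_space (?X ` space \<Omega>)) (count_space (V ` space \<Omega>)) ?X V"
  note simp_X = simple_env_sequence and simp_Y = simple_obs_sequence
  have info: "env_info b M \<Omega> S Ob C = ?I (?F C)" for C
    unfolding env_info_def mutual_info_def obs_family_def[abs_def] ..
  obtain g h where form: "\<forall>x y. \<P>(\<omega> in \<Omega>. ?X \<omega> = x \<and> (\<forall>i\<in>agents M. ?Y i \<omega> = y i)) =
      g x * (\<Prod>i\<in>agents M. h i x (y i))"
    by (rule env_obs_product_form)
  \<comment> \<open>Forgetting the agents outside \<open>C\<close> is a deterministic function of
    the family on \<open>D\<close>, so data processing applies.\<close>
  have "?I (?F C) \<le> ?I (?F D)" if "C \<subseteq> D" "D \<subseteq> agents M" for C D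
  proof -
    have "simple_function \<Omega> (?F D)"
      using that(2) simp_Y by (intro simple_function_family) (auto intro: finite_subset)
    moreover have "restrict (?F D \<omega>) C = ?F C \<omega>" for \<omega>
      using that(1) by (auto simp: fun_eq_iff restrict_def)
    ultimately show ?thesis
      using mutual_information_data_processing[OF simp_X, of "?F D" "\<lambda>w. restrict w C"]
      by (simp only:)
  qed
  \<comment> \<open>The product form \<open>form\<close> supplies the conditional independence of
    the observation sequences given the environment sequence.\<close>
  moreover have "?I (?F (D \<union> {j})) - ?I (?F D) \<le> ?I (?F (C \<union> {j})) - ?I (?F C)"
    if "C \<subseteq> D" "D \<subseteq> agents M" "j \<in> agents M - D" for C D j
    by (rule mutual_information_family_submodular
        [OF finite_agents simp_X simp_Y form[rule_format] that])
  ultimately show ?thesis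
    unfolding info by blast
qed

end
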